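(* Consider the problem (P) of minimizing $\tfrac12 x^THx+c^Tx+f_0(y)$ over $(x,y)\in\mathbb{R}^n\times\mathbb{R}^m$ subject to $x^Tx+f_1(y)\le 0$ and $f_j(y)\le 0$ for $j=2,\dots,k$, where $H=H^T\in\mathbb{R}^{n\times n}$ is not positive semidefinite, $c\in\mathbb{R}^n$, $k\ge 1$, and $f_0,f_1,\dots,f_k:\mathbb{R}^m\to\mathbb{R}$ are convex and twice continuously differentiable. Let $(x_*,y_* )\in\mathbb{R}^n\times\mathbb{R}^m$ be a feasible solution of (P). If there exist $\mu^*_j\ge 0$, $j=1,\dots,k$, such that $$(H+\mu_1^*I)x_*+c=0,$$ $$\nabla f_0(y_* )+\tfrac{\mu_1^*}{2}\nabla f_1(y_* )+\sum_{j=2}^k\mu_j^*\nabla f_j(y_* )=0,$$ $$x_*^Tx_*+f_1(y_* )=0,\qquad \mu_j^*f_j(y_* )=0\ \ (j=2,\dots,k),$$ $$H+\mu_1^*I\succeq 0,$$ then $(x_*,y_* )$ is a global minimizer of (P).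
   Context: $I$ is the $n\times n$ identity matrix, and $P\succeq 0$ means that the symmetric matrix $P$ is positive semidefinite. *)

theory Defs
  imports "HOL-Analysis.Analysis"
begin

definition pos_semidef :: "real ^ 'n ^ 'n \<Rightarrow> bool" where
  "pos_semidef A \<longleftrightarrow> transpose A = A \<and> (\<forall>x. 0 \<le> x \<bullet> (A *v x))"

(* Meaningful only where f is differentiable; see grad_eqI. *)
definition grad :: "('a::real_inner \<Rightarrow> real) \<Rightarrow> 'a \<Rightarrow> 'a" where
  "grad f x = (THE D. GDERIV f x :> D)"

lemma grad_eqI:
  assumes "GDERIV f x :> D"
  shows "grad f x = D"
  unfolding grad_def
proof (rule the_equality)
  show "GDERIV f x :> D" by (rule assms)
next
  fix E assume "GDERIV f x :> E"
  then have eq: "(\<lambda>h. h \<bullet> E) = (\<lambda>h. h \<bullet> D)"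
    using assms unfolding gderiv_def by (rule has_derivative_unique)
  have "h \<bullet> E = h \<bullet> D" for h
    using fun_cong[OF eq, of h] .
  then show "E = D"
    using vector_eq_ldot[of E D] by blast
qed

(* f is twice continuously differentiable on the whole space: it has a gradient g everywhere,
   g is (Frechet) differentiable everywhere, and its Jacobian, the Hessian matrix Q of f,
   depends continuously on the point. *)
definition twice_cont_differentiable :: "(real ^ 'm \<Rightarrow> real) \<Rightarrow> bool" where
  "twice_cont_differentiable f \<longleftrightarrow>
     (\<exists>(g :: real ^ 'm \<Rightarrow> real ^ 'm) (Q :: real ^ 'm \<Rightarrow> real ^ 'm ^ 'm).
        (\<forall>y. GDERIV f y :> g y) \<and>
        (\<forall>y. (g has_derivative (\<lambda>h. Q y *v h)) (at y)) \<and>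
        continuous_on UNIV Q)"

definition objective ::
  "real ^ 'n ^ 'n \<Rightarrow> real ^ 'n \<Rightarrow> (nat \<Rightarrow> real ^ 'm \<Rightarrow> real) \<Rightarrow> (real ^ 'n) \<times> (real ^ 'm) \<Rightarrow> real" where
  "objective H c f = (\<lambda>(x, y). 1 / 2 * (x \<bullet> (H *v x)) + c \<bullet> x + f 0 y)"

definition feasible ::
  "nat \<Rightarrow> (nat \<Rightarrow> real ^ 'm \<Rightarrow> real) \<Rightarrow> (real ^ 'n) \<times> (real ^ 'm) \<Rightarrow> bool" where
  "feasible k f = (\<lambda>(x, y). x \<bullet> x + f 1 y \<le> 0 \<and> (\<forall>j\<in>{2..k}. f j y \<le> 0))"

end

theory Submission
  imports Defs
begin

text \<open>
  On the feasible set the objective dominates its Lagrangian with multipliers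
  \<open>\<mu>\<^sub>1 / 2, \<mu>\<^sub>2, \<dots>, \<mu>\<^sub>k\<close>, with equality at \<open>(x\<^sub>*, y\<^sub>*)\<close> by complementary slackness. The Lagrangian
  separates into a quadratic in \<open>x\<close> with Hessian \<open>H + \<mu>\<^sub>1 I\<close>, which is convex although the original
  one is not, and a convex function of \<open>y\<close>. Both parts are stationary, hence minimal, at
  \<open>(x\<^sub>*, y\<^sub>*)\<close>.
\<close>

text \<open>Composing \<open>f\<close> with the affine path from \<open>y\<close> at time 0 to
  \<open>z\<close> at time 1 gives a convex function of one real variable whose slope at 0 is
  \<open>D \<bullet> (z - y)\<close>. Its tangent at 0, evaluated at 1, is the claim.\<close>

lemma convex_gderiv_above_tangent:
  fixes f :: "'a::real_inner \<Rightarrow> real"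
  assumes convex: "convex_on UNIV f" and deriv: "GDERIV f y :> D"
  shows "f y + D \<bullet> (z - y) \<le> f z"
proof -
  define \<phi> where "\<phi> t = f (y + t *\<^sub>R (z - y))" for t :: real
  have "convex_on UNIV \<phi>"
  proof (rule convex_onI)
    fix t u v :: real
    assume t: "0 < t" "t < 1"
    have "y + ((1 - t) *\<^sub>R u + t *\<^sub>R v) *\<^sub>R (z - y) =
        (1 - t) *\<^sub>R (y + u *\<^sub>R (z - y)) + t *\<^sub>R (y + v *\<^sub>R (z - y))"
      by (simp add: algebra_simps)
    then show "\<phi> ((1 - t) *\<^sub>R u + t *\<^sub>R v) \<le> (1 - t) * \<phi> u + t * \<phi> v"
      using convex_onD[OF convex, of t] t by (simp add: \<phi>_def)
  qed simp
  moreover have "(\<phi> has_field_derivative D \<bullet> (z - y)) (at 0)"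
  proof -
    have "((\<lambda>t. y + t *\<^sub>R (z - y)) has_derivative (\<lambda>t. t *\<^sub>R (z - y))) (at 0)"
      by (auto intro!: derivative_eq_intros)
    moreover have "(f has_derivative (\<lambda>h. h \<bullet> D)) (at (y + 0 *\<^sub>R (z - y)))"
      using deriv by (simp add: gderiv_def)
    ultimately have "(\<phi> has_derivative (\<lambda>t. (t *\<^sub>R (z - y)) \<bullet> D)) (at 0)"
      unfolding \<phi>_def by (rule has_derivative_compose)
    then show ?thesis
      by (simp add: has_field_derivative_def inner_commute mult.commute[of _ "D \<bullet> (z - y)"])
  qed
  ultimately have "D \<bullet> (z - y) * (1 - 0) \<le> \<phi> 1 - \<phi> 0"
    by (intro convex_on_imp_above_tangent[where A = UNIV]) auto
  then show ?thesis
    by (simp add: \<phi>_def)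
qed

text \<open>Since \<open>c = - (A *v x0)\<close> and \<open>A\<close> is symmetric, the right side
  minus the left side is half of \<open>(x - x0) \<bullet> (A *v (x - x0))\<close>.\<close>

lemma pos_semidef_quadratic_minimum:
  fixes A :: "real ^ 'n ^ 'n"
  assumes psd: "pos_semidef A" and stationary: "A *v x0 + c = 0"
  shows "1 / 2 * (x0 \<bullet> (A *v x0)) + c \<bullet> x0 \<le> 1 / 2 * (x \<bullet> (A *v x)) + c \<bullet> x"
proof -
  have c: "c = - (A *v x0)"
    using stationary by (simp add: add_eq_0_iff)
  have sym: "x0 \<bullet> (A *v x) = x \<bullet> (A *v x0)"
    using psd by (metis pos_semidef_def dot_lmul_matrix inner_commute transpose_matrix_vector)
  have "0 \<le> (x - x0) \<bullet> (A *v (x - x0))"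
    using psd by (simp add: pos_semidef_def)
  then show ?thesis
    by (simp add: c sym inner_commute[of "A *v x0"] matrix_vector_mult_diff_distrib algebra_simps)
qed

theorem theorem2:
  fixes H :: "real ^ 'n ^ 'n" and c :: "real ^ 'n"
    and k :: nat and f :: "nat \<Rightarrow> real ^ 'm \<Rightarrow> real"
    and xs :: "real ^ 'n" and ys :: "real ^ 'm"
  assumes "transpose H = H"
    and "\<not> pos_semidef H"
    and "1 \<le> k"
    and "\<And>j. j \<le> k \<Longrightarrow> convex_on UNIV (f j)"
    and "\<And>j. j \<le> k \<Longrightarrow> twice_cont_differentiable (f j)"
    and "feasible k f (xs, ys)"
    and "\<exists>\<mu> :: nat \<Rightarrow> real.
           (\<forall>j\<in>{1..k}. 0 \<le> \<mu> j) \<and>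
           (H + \<mu> 1 *\<^sub>R mat 1) *v xs + c = 0 \<and>
           grad (f 0) ys + (\<mu> 1 / 2) *\<^sub>R grad (f 1) ys
             + (\<Sum>j = 2..k. \<mu> j *\<^sub>R grad (f j) ys) = 0 \<and>
           xs \<bullet> xs + f 1 ys = 0 \<and>
           (\<forall>j\<in>{2..k}. \<mu> j * f j ys = 0) \<and>
           pos_semidef (H + \<mu> 1 *\<^sub>R mat 1)"
  shows "is_arg_min (objective H c f) (feasible k f) (xs, ys)"
proof -
  obtain \<mu> :: "nat \<Rightarrow> real" where
    nonneg: "\<And>j. j \<in> {1..k} \<Longrightarrow> 0 \<le> \<mu> j" and
    stat_x: "(H + \<mu> 1 *\<^sub>R mat 1) *v xs + c = 0" and
    stat_y: "grad (f 0) ys + (\<mu> 1 / 2) *\<^sub>R grad (f 1) ys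
      + (\<Sum>j = 2..k. \<mu> j *\<^sub>R grad (f j) ys) = 0" and
    active: "xs \<bullet> xs + f 1 ys = 0" and
    slack: "\<And>j. j \<in> {2..k} \<Longrightarrow> \<mu> j * f j ys = 0" and
    psd: "pos_semidef (H + \<mu> 1 *\<^sub>R mat 1)"
    using assms(7) by blast
  have \<mu>1: "0 \<le> \<mu> 1"
    using nonneg \<open>1 \<le> k\<close> by simp
  have "objective H c f (xs, ys) \<le> objective H c f (x, y)" if feas: "feasible k f (x, y)" for x y
  proof -
    have feas1: "x \<bullet> x + f 1 y \<le> 0" and feasj: "\<And>j. j \<in> {2..k} \<Longrightarrow> f j y \<le> 0"
      using feas by (auto simp: feasible_def)
    \<comment> \<open>Differentiability of \<open>f j\<close> enters here: it makes
      \<open>grad (f j) ys\<close> a genuine gradient.\<close>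
    have tangent: "f j ys + grad (f j) ys \<bullet> (y - ys) \<le> f j y" if j: "j \<le> k" for j
    proof -
      obtain D where D: "GDERIV (f j) ys :> D"
        using assms(5)[OF j] by (auto simp: twice_cont_differentiable_def)
      then show ?thesis
        using convex_gderiv_above_tangent[OF assms(4)[OF j] D, of y] by (simp add: grad_eqI)
    qed
    \<comment> \<open>The tangent value at \<open>y\<close> lies below \<open>f j y \<le> 0\<close>;
      weighting by \<open>\<mu> j\<close> and using slackness at \<open>ys\<close> leaves only the
      gradient term. The index 1 stays out, because feasibility bounds
      \<open>x \<bullet> x + f 1 y\<close> and not \<open>f 1 y\<close> alone.\<close>
    have tangent_sum: "(\<Sum>j = 2..k. \<mu> j * (grad (f j) ys \<bullet> (y - ys))) \<le> 0"
    proof (rule sum_nonpos)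
      fix j assume j: "j \<in> {2..k}"
      have "\<mu> j * (f j ys + grad (f j) ys \<bullet> (y - ys)) \<le> \<mu> j * f j y"
        using tangent nonneg j by (intro mult_left_mono) auto
      also have "\<dots> \<le> 0"
        using nonneg feasj j by (intro mult_nonneg_nonpos) auto
      finally show "\<mu> j * (grad (f j) ys \<bullet> (y - ys)) \<le> 0"
        using slack[OF j] by (simp add: distrib_left)
    qed
    have "(grad (f 0) ys + (\<mu> 1 / 2) *\<^sub>R grad (f 1) ys
      + (\<Sum>j = 2..k. \<mu> j *\<^sub>R grad (f j) ys)) \<bullet> (y - ys) = 0"
      using stat_y by simp
    then have "grad (f 0) ys \<bullet> (y - ys) + \<mu> 1 / 2 * (grad (f 1) ys \<bullet> (y - ys))
        + (\<Sum>j = 2..k. \<mu> j * (grad (f j) ys \<bullet> (y - ys))) = 0"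
      by (simp only: inner_add_left inner_sum_left inner_scaleR_left)
    moreover have "\<mu> 1 / 2 * (f 1 ys + grad (f 1) ys \<bullet> (y - ys)) \<le> \<mu> 1 / 2 * f 1 y"
      using tangent[of 1] \<mu>1 \<open>1 \<le> k\<close> by (intro mult_left_mono) auto
    \<comment> \<open>By stationarity the gradient terms for 0 and 1 add up to minus the sum in
      \<open>tangent_sum\<close>, hence to something nonnegative.\<close>
    ultimately have lagrangian_y: "f 0 ys + \<mu> 1 / 2 * f 1 ys \<le> f 0 y + \<mu> 1 / 2 * f 1 y"
      using tangent[of 0] tangent_sum unfolding distrib_left by linarith
    \<comment> \<open>The shift by \<open>\<mu> 1\<close> contributes
      \<open>\<mu> 1 / 2 * (v \<bullet> v)\<close> to half the quadratic form, which explains the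
      weight \<open>\<mu> 1 / 2\<close> on \<open>f 1\<close>.\<close>
    have shift: "v \<bullet> ((H + \<mu> 1 *\<^sub>R mat 1) *v v) = v \<bullet> (H *v v) + \<mu> 1 * (v \<bullet> v)" for v
      by (simp add: matrix_vector_mult_add_rdistrib inner_add_right
          flip: scaleR_matrix_vector_assoc)
    have lagrangian_x: "1 / 2 * (xs \<bullet> (H *v xs)) + \<mu> 1 / 2 * (xs \<bullet> xs) + c \<bullet> xs
        \<le> 1 / 2 * (x \<bullet> (H *v x)) + \<mu> 1 / 2 * (x \<bullet> x) + c \<bullet> x"
      using pos_semidef_quadratic_minimum[OF psd stat_x, of x] unfolding shift
      by (simp add: algebra_simps)
    \<comment> \<open>The weighted first constraint vanishes at the candidate and is nonpositive at
      \<open>(x, y)\<close>, so both Lagrangian inequalities together compare the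
      objectives.\<close>
    have "\<mu> 1 / 2 * (xs \<bullet> xs) + \<mu> 1 / 2 * f 1 ys = 0"
      unfolding distrib_left[symmetric] active by simp
    moreover have "\<mu> 1 / 2 * (x \<bullet> x) + \<mu> 1 / 2 * f 1 y \<le> 0"
      unfolding distrib_left[symmetric] using \<mu>1 feas1 by (intro mult_nonneg_nonpos) auto
    ultimately show ?thesis
      using lagrangian_x lagrangian_y unfolding objective_def prod.case by linarith
  qed
  then show ?thesis
    using assms(6) by (fastforce simp: is_arg_min_def not_less)
qed

end
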